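(* Let $A_h\le\alpha_h^2B_h$ in $H_h$ and let the condition $\frac16h_t^2\alpha_h^2\le(1-\varepsilon_0^2)\underline\rho$ be valid for some $0<\varepsilon_0<1$. Let $w\in H_h$ be the solution to the equation $$B_h(\rho w)+\tfrac1{12}h_t^2A_hw=b\quad\text{in }H_h,$$ with a given $b\in H_h$. Let $N\ge1$. For the $N$-step iterative method with the Chebyshev parameters $$w^{(l+1)}=(1-\theta^{(l)})w^{(l)}-\frac{\theta^{(l)}}{\rho}B_h^{-1}\big(\tfrac1{12}h_t^2A_hw^{(l)}-b\big),\qquad\theta^{(l)}:=\frac{\theta_{opt}}{1+q_0\cos\frac{\pi(l+1/2)}N},\quad l=0,\ldots,N-1,$$ the convergence rate estimate $$\|w-w^{(N)}\|\le\frac{2q_1^N}{1+q_1^{2N}}\|w-w^{(0)}\|\quad\forall w^{(0)}\in H_h$$ holds in the two norms $\|\cdot\|=\|\sqrt\rho\,\cdot\|_h$ and $\|\cdot\|=\|\cdot\|_{\mathcal A_{\mathbf h}}$, with $$q_1=q_1(\varepsilon_0^2):=\frac{\bar\lambda^{1/2}(\varepsilon_0^2)-1}{\bar\lambda^{1/2}(\varepsilon_0^2)+1}=\frac{1-\varepsilon_0^2}{5-\varepsilon_0^2+4\sqrt{1+\frac12(1-\varepsilon_0^2)}}\le\frac1{5+4\sqrt{1.5}}\approx0.1010\quad\text{for }\varepsilon_0^2\in[0,1).$$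
   Context: $H_h$ is a finite-dimensional Euclidean space of real functions on a spatial mesh (e.g. functions on a uniform rectangular mesh vanishing at boundary nodes) with a mesh $L^2$ inner product $(\cdot,\cdot)_h$ and norm $\|\cdot\|_h$. $A_h=A_h^*>0$ and $B_h=B_h^*>0$ are any commuting linear operators in $H_h$. $\rho(x)\ge\underline\rho>0$ is a given function, $\underline\rho$ constant; $D_\rho w:=\rho w$ (pointwise multiplication). $h_t>0$ is the time step. For $C_h=C_h^*>0$ in $H_h$, $\|w\|_{C_h}=(C_hw,w)_h^{1/2}$; $\mathcal A_{\mathbf h}:=D_\rho+\frac1{12}h_t^2B_h^{-1}A_h$. The constants are $\bar\lambda(\varepsilon_0^2)=1+\frac12(1-\varepsilon_0^2)$, $\theta_{opt}=2/(1+\bar\lambda(\varepsilon_0^2))$, $q_0=\frac{\bar\lambda(\varepsilon_0^2)-1}{\bar\lambda(\varepsilon_0^2)+1}$. *)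

theory Defs
  imports "HOL-Analysis.Analysis"
begin

text \<open>
  The finite type \<open>'n\<close> is the set of mesh nodes, so that a mesh function is a vector of type
  \<open>real ^ 'n\<close>. The function \<open>\<mu>\<close> gives the quadrature weight of each node (for instance
  the product of the mesh steps).
\<close>

definition mesh_inner :: "('n::finite \<Rightarrow> real) \<Rightarrow> real ^ 'n \<Rightarrow> real ^ 'n \<Rightarrow> real" where
  "mesh_inner \<mu> u v = (\<Sum>i\<in>UNIV. \<mu> i * u $ i * v $ i)"

definition mesh_norm :: "('n::finite \<Rightarrow> real) \<Rightarrow> real ^ 'n \<Rightarrow> real" where
  "mesh_norm \<mu> w = sqrt (mesh_inner \<mu> w w)"

text \<open>
  The space \<open>H\<close> may be a proper subspace of all mesh functions, e.g. the functions vanishing at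
  the boundary nodes. Weights may be zero (e.g. at boundary nodes), as long as the
  form is definite on \<open>H\<close>.
\<close>

definition euclidean_mesh_space :: "('n::finite \<Rightarrow> real) \<Rightarrow> (real ^ 'n) set \<Rightarrow> bool" where
  "euclidean_mesh_space \<mu> H \<longleftrightarrow>
     subspace H \<and> (\<forall>i. 0 \<le> \<mu> i) \<and> (\<forall>w\<in>H. w \<noteq> 0 \<longrightarrow> 0 < mesh_inner \<mu> w w)"

text \<open>Operators in \<open>H\<close> are total functions of which only the values on \<open>H\<close> matter.\<close>

definition linear_operator_in :: "(real ^ 'n::finite) set \<Rightarrow> (real ^ 'n \<Rightarrow> real ^ 'n) \<Rightarrow> bool" where
  "linear_operator_in H C \<longleftrightarrow>
     (\<forall>w\<in>H. C w \<in> H) \<and>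
     (\<forall>u\<in>H. \<forall>v\<in>H. C (u + v) = C u + C v) \<and>
     (\<forall>c. \<forall>w\<in>H. C (c *\<^sub>R w) = c *\<^sub>R C w)"

definition selfadjoint_pos ::
  "('n::finite \<Rightarrow> real) \<Rightarrow> (real ^ 'n) set \<Rightarrow> (real ^ 'n \<Rightarrow> real ^ 'n) \<Rightarrow> bool" where
  "selfadjoint_pos \<mu> H C \<longleftrightarrow>
     linear_operator_in H C \<and>
     (\<forall>u\<in>H. \<forall>v\<in>H. mesh_inner \<mu> (C u) v = mesh_inner \<mu> u (C v)) \<and>
     (\<forall>w\<in>H. w \<noteq> 0 \<longrightarrow> 0 < mesh_inner \<mu> (C w) w)"

definition operator_le ::
  "('n::finite \<Rightarrow> real) \<Rightarrow> (real ^ 'n) set \<Rightarrow> (real ^ 'n \<Rightarrow> real ^ 'n) \<Rightarrow> (real ^ 'n \<Rightarrow> real ^ 'n) \<Rightarrow> bool"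
  where
  "operator_le \<mu> H C D \<longleftrightarrow> (\<forall>w\<in>H. mesh_inner \<mu> (C w) w \<le> mesh_inner \<mu> (D w) w)"

definition op_norm :: "('n::finite \<Rightarrow> real) \<Rightarrow> (real ^ 'n \<Rightarrow> real ^ 'n) \<Rightarrow> real ^ 'n \<Rightarrow> real" where
  "op_norm \<mu> C w = sqrt (mesh_inner \<mu> (C w) w)"

definition pointwise_mult :: "('n::finite \<Rightarrow> real) \<Rightarrow> real ^ 'n \<Rightarrow> real ^ 'n" where
  "pointwise_mult f w = (\<chi> i. f i * w $ i)"

definition op_A_bold ::
  "(real ^ 'n::finite) set \<Rightarrow> ('n \<Rightarrow> real) \<Rightarrow> real \<Rightarrow> (real ^ 'n \<Rightarrow> real ^ 'n) \<Rightarrow> (real ^ 'n \<Rightarrow> real ^ 'n)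
   \<Rightarrow> real ^ 'n \<Rightarrow> real ^ 'n" where
  "op_A_bold H \<rho> ht A B w = pointwise_mult \<rho> w + (1/12 * ht\<^sup>2) *\<^sub>R inv_into H B (A w)"

text \<open>The constants below take \<open>s\<close> = \<open>\<epsilon>\<^sub>0\<^sup>2\<close> as their argument.\<close>

definition lambda_bar :: "real \<Rightarrow> real" where
  "lambda_bar s = 1 + 1/2 * (1 - s)"

definition theta_opt :: "real \<Rightarrow> real" where
  "theta_opt s = 2 / (1 + lambda_bar s)"

definition q0 :: "real \<Rightarrow> real" where
  "q0 s = (lambda_bar s - 1) / (lambda_bar s + 1)"

definition q1 :: "real \<Rightarrow> real" where
  "q1 s = (sqrt (lambda_bar s) - 1) / (sqrt (lambda_bar s) + 1)"

definition cheb_theta :: "real \<Rightarrow> nat \<Rightarrow> nat \<Rightarrow> real" where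
  "cheb_theta s N l = theta_opt s / (1 + q0 s * cos (pi * (real l + 1/2) / real N))"

definition cheb_step ::
  "(real ^ 'n::finite) set \<Rightarrow> ('n \<Rightarrow> real) \<Rightarrow> real \<Rightarrow> (real ^ 'n \<Rightarrow> real ^ 'n) \<Rightarrow> (real ^ 'n \<Rightarrow> real ^ 'n)
   \<Rightarrow> real ^ 'n \<Rightarrow> real \<Rightarrow> real ^ 'n \<Rightarrow> real ^ 'n" where
  "cheb_step H \<rho> ht A B b \<theta> v =
     (1 - \<theta>) *\<^sub>R v
     - pointwise_mult (\<lambda>i. \<theta> / \<rho> i) (inv_into H B ((1/12 * ht\<^sup>2) *\<^sub>R A v - b))"

end

theory Submission
  imports Defs "HOL-Computational_Algebra.Polynomial"
begin

text \<open>
  Put \<open>e = w - W\<close>. Subtracting the equation for \<open>w\<close> from a step of the method gives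
  \<open>e' = e - \<theta> S e\<close> with the operator
  \<open>S = I + (h\<^sup>2 / 12) \<rho>\<^sup>-\<^sup>1 B\<^sup>-\<^sup>1 A = \<rho>\<^sup>-\<^sup>1 \<A>\<close>, where \<open>\<A>\<close> is the operator of the energy norm
  (\<open>cheb_step_error\<close>). Since \<open>A\<close> and \<open>B\<close> commute, \<open>B\<^sup>-\<^sup>1 A\<close> is symmetric, so \<open>S\<close> is symmetric for
  the inner product with weights \<open>\<mu> \<rho>\<close>. Its quadratic form lies between \<open>1\<close> and \<open>lambda_bar\<close> times
  the square of the weighted norm: on an eigenvector of \<open>B\<^sup>-\<^sup>1 A\<close> the comparison \<open>A \<le> \<alpha>\<^sup>2 B\<close> bounds the
  eigenvalue by \<open>\<alpha>\<^sup>2\<close>, and the condition on the time step does the rest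
  (\<open>normalized_operator_spectrum\<close>).

  Both norms of the theorem are diagonal in an eigenbasis of \<open>S\<close> that is orthogonal for the weights
  \<open>\<mu> \<rho>\<close>: their squares are \<open>(e, e)\<close> and \<open>(S e, e)\<close> in that inner product. After \<open>N\<close> steps the
  coefficient at an eigenvalue \<open>x\<close> has been multiplied by the product of the \<open>1 - \<theta> x\<close>, so each of
  the two norms shrinks at least by the maximum of that polynomial on the interval from \<open>1\<close> to
  \<open>lambda_bar\<close> (\<open>residual_polynomial_bound\<close>). The parameters are chosen so that this polynomial is
  the Chebyshev polynomial \<open>T\<^sub>N\<close>, transported affinely from \<open>[-1, 1]\<close> to that interval and normalized
  to be \<open>1\<close> at \<open>x = 0\<close>, a point that corresponds to \<open>1 / q0\<close>. Its maximum is therefore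
  \<open>1 / T\<^sub>N (1 / q0)\<close>, and since \<open>1 / q0 = (q1 + 1 / q1) / 2\<close>, this is the stated rate
  (\<open>chebyshev_residual_bound\<close>).
\<close>

section \<open>Symmetric operators in a Euclidean mesh space\<close>

definition symmetric_in ::
  "('n::finite \<Rightarrow> real) \<Rightarrow> (real ^ 'n) set \<Rightarrow> (real ^ 'n \<Rightarrow> real ^ 'n) \<Rightarrow> bool" where
  "symmetric_in \<nu> H S \<longleftrightarrow> linear_operator_in H S \<and>
     (\<forall>u\<in>H. \<forall>v\<in>H. mesh_inner \<nu> (S u) v = mesh_inner \<nu> u (S v))"

lemma mesh_inner_add_left: "mesh_inner \<nu> (u + v) w = mesh_inner \<nu> u w + mesh_inner \<nu> v w"
  by (simp add: mesh_inner_def algebra_simps sum.distrib)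

lemma mesh_inner_scaleR_left: "mesh_inner \<nu> (c *\<^sub>R u) w = c * mesh_inner \<nu> u w"
  by (simp add: mesh_inner_def sum_distrib_left mult_ac)

lemma mesh_inner_commute: "mesh_inner \<nu> u v = mesh_inner \<nu> v u"
  by (simp add: mesh_inner_def mult_ac)

lemma mesh_inner_add_right: "mesh_inner \<nu> w (u + v) = mesh_inner \<nu> w u + mesh_inner \<nu> w v"
  by (metis mesh_inner_add_left mesh_inner_commute)

lemma mesh_inner_scaleR_right: "mesh_inner \<nu> w (c *\<^sub>R u) = c * mesh_inner \<nu> w u"
  by (metis mesh_inner_scaleR_left mesh_inner_commute)

lemma mesh_inner_zero_left: "mesh_inner \<nu> 0 w = 0"
  by (simp add: mesh_inner_def)

lemma mesh_inner_diff_left: "mesh_inner \<nu> (u - v) w = mesh_inner \<nu> u w - mesh_inner \<nu> v w"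
  by (simp add: mesh_inner_def algebra_simps sum_subtractf)

lemma mesh_inner_diff_right: "mesh_inner \<nu> w (u - v) = mesh_inner \<nu> w u - mesh_inner \<nu> w v"
  by (metis mesh_inner_diff_left mesh_inner_commute)

lemma mesh_inner_sum_left: "mesh_inner \<nu> (\<Sum>k\<in>I. f k) w = (\<Sum>k\<in>I. mesh_inner \<nu> (f k) w)"
  by (induction I rule: infinite_finite_induct)
     (auto simp: mesh_inner_zero_left mesh_inner_add_left)

lemma mesh_inner_sum_right: "mesh_inner \<nu> w (\<Sum>k\<in>I. f k) = (\<Sum>k\<in>I. mesh_inner \<nu> w (f k))"
  by (metis (no_types, lifting) mesh_inner_commute mesh_inner_sum_left sum.cong)

lemmas mesh_inner_bilinear =
  mesh_inner_add_left mesh_inner_add_right mesh_inner_diff_left mesh_inner_diff_right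
  mesh_inner_scaleR_left mesh_inner_scaleR_right

text \<open>
  The values of an operator outside \<open>H\<close> are arbitrary. Composing it with a linear projection onto \<open>H\<close>
  makes continuity and the dimension theory of globally linear maps available.
\<close>

lemma linear_operator_in_extend:
  assumes "subspace H" "linear_operator_in H S"
  obtains F where "linear F" "\<And>v. v \<in> H \<Longrightarrow> F v = S v"
proof -
  obtain B where B: "B \<subseteq> H" "independent B" "span B = H"
    using basis_exists[of H] assms(1) by (metis span_eq_iff span_mono subset_antisym)
  obtain g where g: "linear g" "\<forall>x\<in>B. g x = x" "range g = span ((\<lambda>x. x) ` B)"
    using linear_independent_extend_subspace[OF B(2), of "\<lambda>x. x"] by blast
  have gH: "g v \<in> H" for v
    using g(3) B(3) by auto
  have gid: "g v = v" if "v \<in> H" for v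
    using linear_eq_on[OF g(1) linear_id, of v B] that B(3) g(2) by auto
  have "linear (\<lambda>v. S (g v))"
  proof (rule linearI)
    show "S (g (x + y)) = S (g x) + S (g y)" for x y
      using gH assms(2) by (simp add: linear_add[OF g(1)] linear_operator_in_def)
    show "S (g (c *\<^sub>R x)) = c *\<^sub>R S (g x)" for c x
      using gH assms(2) by (simp add: linear_cmul[OF g(1)] linear_operator_in_def)
  qed
  then show thesis
    using that gid by metis
qed

text \<open>
  A maximizer \<open>u\<close> of the Rayleigh quotient, with maximum \<open>c\<close>, is an eigenvector: the form of
  \<open>D = c I - S\<close> is nonnegative and vanishes at \<open>u\<close>, and a nonnegative form that vanishes at \<open>u\<close>
  annihilates \<open>u\<close>, since moving from \<open>u\<close> a little against \<open>D u\<close> would make it negative. The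
  quotient is maximized over the unit vectors of \<open>H\<close> for the ambient norm, which form a compact set
  whatever the weights are; homogeneity carries the bound to all of \<open>H\<close>.
\<close>

lemma symmetric_in_eigenvector:
  assumes H: "euclidean_mesh_space \<nu> H" and S: "symmetric_in \<nu> H S" and nz: "H \<noteq> {0}"
  obtains u c where "u \<in> H" "u \<noteq> 0" "S u = c *\<^sub>R u"
proof -
  have sub: "subspace H" and pos: "\<And>v. v \<in> H \<Longrightarrow> v \<noteq> 0 \<Longrightarrow> 0 < mesh_inner \<nu> v v"
    using H by (auto simp: euclidean_mesh_space_def)
  have lin: "linear_operator_in H S"
    and sym: "\<And>u v. u \<in> H \<Longrightarrow> v \<in> H \<Longrightarrow> mesh_inner \<nu> (S u) v = mesh_inner \<nu> u (S v)"
    using S by (auto simp: symmetric_in_def)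
  have SH: "S v \<in> H" if "v \<in> H" for v
    using lin that by (simp add: linear_operator_in_def)
  have Sadd: "S (u + v) = S u + S v" if "u \<in> H" "v \<in> H" for u v
    using lin that by (simp add: linear_operator_in_def)
  have Sscale: "S (c *\<^sub>R v) = c *\<^sub>R S v" if "v \<in> H" for c v
    using lin that by (simp add: linear_operator_in_def)
  obtain F where F: "linear F" and FS: "\<And>v. v \<in> H \<Longrightarrow> F v = S v"
    using linear_operator_in_extend[OF sub lin] by blast
  define R where "R v = mesh_inner \<nu> (F v) v / mesh_inner \<nu> v v" for v
  let ?K = "sphere 0 1 \<inter> H"
  have compact: "compact ?K"
    by (intro compact_Int_closed compact_sphere closed_subspace sub)
  have nonempty: "?K \<noteq> {}"
  proof -
    obtain x where x: "x \<in> H" "x \<noteq> 0"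
      using nz subspace_0[OF sub] by blast
    then have "(1 / norm x) *\<^sub>R x \<in> ?K"
      using sub by (auto simp: subspace_scale)
    then show ?thesis by blast
  qed
  have cont: "continuous_on ?K R"
  proof -
    have "continuous_on ?K F"
      using F by (simp add: linear_continuous_on linear_conv_bounded_linear)
    moreover have "mesh_inner \<nu> v v \<noteq> 0" if "v \<in> ?K" for v
      using pos[of v] that by fastforce
    ultimately show ?thesis
      unfolding R_def mesh_inner_def by (intro continuous_intros) auto
  qed
  obtain u where u: "u \<in> ?K" and umax: "\<And>v. v \<in> ?K \<Longrightarrow> R v \<le> R u"
    using continuous_attains_sup[OF compact nonempty cont] by auto
  have uH: "u \<in> H" and u0: "u \<noteq> 0"
    using u by auto
  define c where "c = R u"
  define D where "D v = c *\<^sub>R v - S v" for v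
  have DH: "D v \<in> H" if "v \<in> H" for v
    using that sub SH by (simp add: D_def subspace_diff subspace_scale)
  have bound: "mesh_inner \<nu> (S v) v \<le> c * mesh_inner \<nu> v v" if "v \<in> H" for v
  proof (cases "v = 0")
    case True
    then show ?thesis by (simp add: mesh_inner_def)
  next
    case False
    define k where "k = 1 / norm v"
    have k: "k \<noteq> 0" using False by (simp add: k_def)
    have "k *\<^sub>R v \<in> ?K"
      using False that sub by (auto simp: k_def subspace_scale)
    then have "R (k *\<^sub>R v) \<le> c"
      using umax c_def by simp
    moreover have "R (k *\<^sub>R v) = R v"
      using k by (simp add: R_def linear_cmul[OF F] mesh_inner_bilinear)
    ultimately have "R v \<le> c" by simp
    then show ?thesis
      using pos[OF that False] FS[OF that] by (simp add: R_def divide_le_eq mult.commute)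
  qed
  have Dnn: "0 \<le> mesh_inner \<nu> (D v) v" if "v \<in> H" for v
    using bound[OF that] by (simp add: D_def mesh_inner_bilinear)
  have D0: "mesh_inner \<nu> (D u) u = 0"
    using pos[OF uH u0] FS[OF uH] by (simp add: D_def c_def R_def mesh_inner_bilinear)
  define z where "z = D u"
  have zH: "z \<in> H" using DH uH z_def by simp
  have "z = 0"
  proof (rule ccontr)
    assume "z \<noteq> 0"
    define n where "n = mesh_inner \<nu> z z"
    define q where "q = mesh_inner \<nu> (D z) z"
    have n: "0 < n" and q: "0 \<le> q"
      using pos[OF zH \<open>z \<noteq> 0\<close>] Dnn[OF zH] by (auto simp: n_def q_def)
    \<comment> \<open>The minimizer \<open>- n / q\<close> of \<open>2 t n + t\<^sup>2 q\<close>, with \<open>q + 1\<close> in place of \<open>q\<close> because \<open>q\<close> may be \<open>0\<close>.\<close>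
    define t where "t = - n / (q + 1)"
    have Duz: "D (u + t *\<^sub>R z) = D u + t *\<^sub>R D z"
      using uH zH sub by (simp add: D_def Sadd Sscale subspace_scale algebra_simps)
    have Dzu: "mesh_inner \<nu> (D z) u = mesh_inner \<nu> z z"
      using sym[OF zH uH]
      by (simp add: mesh_inner_bilinear D_def z_def)
    have "0 \<le> mesh_inner \<nu> (D (u + t *\<^sub>R z)) (u + t *\<^sub>R z)"
      using uH zH sub by (intro Dnn subspace_add subspace_scale)
    also have "\<dots> = 2 * t * n + t\<^sup>2 * q"
      unfolding Duz using D0 Dzu
      by (simp add: mesh_inner_bilinear n_def q_def z_def power2_eq_square algebra_simps)
    also have "\<dots> = - (n\<^sup>2 * (q + 2)) / (q + 1)\<^sup>2"
      using q by (simp add: t_def field_simps power2_eq_square add_nonneg_eq_0_iff)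
    also have "\<dots> < 0"
      using n q by (simp add: divide_neg_pos)
    finally show False by simp
  qed
  then have "S u = c *\<^sub>R u"
    by (simp add: z_def D_def)
  then show thesis
    using that uH u0 by blast
qed

text \<open>
  Induction on the dimension: the orthogonal complement in \<open>H\<close> of an eigenvector is invariant by
  symmetry, and it is again a Euclidean mesh space with the same weights.
\<close>

lemma spectral_basis:
  assumes "euclidean_mesh_space \<nu> H" "symmetric_in \<nu> H S"
  shows "\<exists>E ev. finite E \<and> E \<subseteq> H - {0} \<and> H \<subseteq> span E \<and>
    (\<forall>v\<in>E. S v = ev v *\<^sub>R v) \<and> (\<forall>u\<in>E. \<forall>v\<in>E. u \<noteq> v \<longrightarrow> mesh_inner \<nu> u v = 0)"
  using assms
proof (induction "dim H" arbitrary: H rule: less_induct)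
  case less
  show ?case
  proof (cases "H = {0}")
    case True
    then show ?thesis
      by (intro exI[of _ "{}"]) auto
  next
    case False
    obtain u c where u: "u \<in> H" "u \<noteq> 0" "S u = c *\<^sub>R u"
      using symmetric_in_eigenvector[OF less.prems False] by metis
    have sub: "subspace H" and upos: "0 < mesh_inner \<nu> u u"
      using less.prems(1) u by (auto simp: euclidean_mesh_space_def)
    define H' where "H' = {v \<in> H. mesh_inner \<nu> v u = 0}"
    have sub': "subspace H'"
      using sub unfolding subspace_def H'_def
      by (auto simp: mesh_inner_bilinear mesh_inner_zero_left)
    have "u \<notin> H'" and "H' \<subseteq> H"
      using upos by (auto simp: H'_def)
    moreover have "span H' = H'" "span H = H"
      using sub sub' by simp_all
    ultimately have "span H' \<subset> span H"
      using u(1) by (simp only:) blast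
    then have "dim H' < dim H"
      by (rule dim_psubset)
    moreover have "euclidean_mesh_space \<nu> H'"
      using less.prems(1) sub' by (auto simp: euclidean_mesh_space_def H'_def)
    moreover have "symmetric_in \<nu> H' S"
    proof -
      have "mesh_inner \<nu> (S v) u = 0" if "v \<in> H'" for v
        using that less.prems(2) u
        by (auto simp: symmetric_in_def H'_def mesh_inner_bilinear)
      then show ?thesis
        using less.prems(2) \<open>H' \<subseteq> H\<close>
        by (auto simp: symmetric_in_def linear_operator_in_def H'_def)
    qed
    ultimately obtain E ev where E: "finite E" "E \<subseteq> H' - {0}" "H' \<subseteq> span E"
        "\<forall>v\<in>E. S v = ev v *\<^sub>R v" "\<forall>v\<in>E. \<forall>w\<in>E. v \<noteq> w \<longrightarrow> mesh_inner \<nu> v w = 0"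
      using less.hyps[of H'] by blast
    have orth: "mesh_inner \<nu> v u = 0" "mesh_inner \<nu> u v = 0" if "v \<in> E" for v
      using that E(2) by (auto simp: H'_def mesh_inner_commute[of \<nu> u])
    have "u \<notin> E"
      using \<open>u \<notin> H'\<close> E(2) by blast
    have "v \<in> span (insert u E)" if "v \<in> H" for v
    proof -
      define k where "k = mesh_inner \<nu> v u / mesh_inner \<nu> u u"
      have "v - k *\<^sub>R u \<in> H'"
        using that u sub upos
        by (simp add: H'_def k_def subspace_diff subspace_scale mesh_inner_bilinear)
      then show ?thesis
        unfolding span_insert using E(3) by blast
    qed
    then show ?thesis
      using E u \<open>u \<notin> E\<close> \<open>H' \<subseteq> H\<close> orth
      by (intro exI[of _ "insert u E"] exI[of _ "\<lambda>v. if v = u then c else ev v"]) auto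
  qed
qed

lemma spectral_expansion:
  assumes H: "euclidean_mesh_space \<nu> H" and S: "symmetric_in \<nu> H S" and e: "e \<in> H"
  shows "\<exists>E ev a. finite E \<and> E \<subseteq> H - {0} \<and> (\<forall>v\<in>E. S v = ev v *\<^sub>R v) \<and>
    (\<forall>u\<in>E. \<forall>v\<in>E. u \<noteq> v \<longrightarrow> mesh_inner \<nu> u v = 0) \<and> e = (\<Sum>v\<in>E. a v *\<^sub>R v)"
proof -
  obtain E ev where E: "finite E" "E \<subseteq> H - {0}" "H \<subseteq> span E"
    "\<forall>v\<in>E. S v = ev v *\<^sub>R v" "\<forall>u\<in>E. \<forall>v\<in>E. u \<noteq> v \<longrightarrow> mesh_inner \<nu> u v = 0"
    using spectral_basis[OF H S] by blast
  have "e \<in> range (\<lambda>a. \<Sum>v\<in>E. a v *\<^sub>R v)"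
    using e E(3) unfolding span_finite[OF E(1)] by blast
  with E show ?thesis
    by blast
qed

lemma linear_operator_in_sum:
  assumes "linear_operator_in H S" "subspace H" "finite E" "E \<subseteq> H"
  shows "S (\<Sum>v\<in>E. a v *\<^sub>R v) = (\<Sum>v\<in>E. a v *\<^sub>R S v)"
proof -
  obtain F where F: "linear F" "\<And>v. v \<in> H \<Longrightarrow> F v = S v"
    using linear_operator_in_extend assms(1,2) by blast
  have "(\<Sum>v\<in>E. a v *\<^sub>R v) \<in> H"
    using assms by (intro subspace_sum subspace_scale) auto
  then have "S (\<Sum>v\<in>E. a v *\<^sub>R v) = F (\<Sum>v\<in>E. a v *\<^sub>R v)"
    using F(2) by simp
  also have "\<dots> = (\<Sum>v\<in>E. a v *\<^sub>R F v)"
    using F(1) by (simp add: linear_sum linear_cmul)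
  also have "\<dots> = (\<Sum>v\<in>E. a v *\<^sub>R S v)"
    using F(2) assms(4) by (intro sum.cong) auto
  finally show ?thesis .
qed

lemma mesh_inner_orthogonal_sum:
  assumes "finite E" "\<forall>u\<in>E. \<forall>v\<in>E. u \<noteq> v \<longrightarrow> mesh_inner \<nu> u v = 0"
  shows "mesh_inner \<nu> (\<Sum>v\<in>E. a v *\<^sub>R v) (\<Sum>v\<in>E. b v *\<^sub>R v) = (\<Sum>v\<in>E. a v * b v * mesh_inner \<nu> v v)"
proof -
  have "mesh_inner \<nu> (a u *\<^sub>R u) (\<Sum>v\<in>E. b v *\<^sub>R v) = a u * b u * mesh_inner \<nu> u u"
    if "u \<in> E" for u
  proof -
    have "mesh_inner \<nu> (a u *\<^sub>R u) (\<Sum>v\<in>E. b v *\<^sub>R v)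
        = (\<Sum>v\<in>E. if v = u then a u * b u * mesh_inner \<nu> u u else 0)"
      unfolding mesh_inner_sum_right
      by (intro sum.cong refl) (use assms that in \<open>auto simp: mesh_inner_bilinear\<close>)
    then show ?thesis
      using assms(1) that by simp
  qed
  then show ?thesis
    by (simp add: mesh_inner_sum_left)
qed

lemma form_bounds_from_eigenvalues:
  assumes H: "euclidean_mesh_space \<nu> H" and S: "symmetric_in \<nu> H S" and e: "e \<in> H"
    and eig: "\<And>v c. v \<in> H \<Longrightarrow> v \<noteq> 0 \<Longrightarrow> S v = c *\<^sub>R v \<Longrightarrow> lo \<le> c \<and> c \<le> hi"
  shows "lo * mesh_inner \<nu> e e \<le> mesh_inner \<nu> (S e) e \<and>
    mesh_inner \<nu> (S e) e \<le> hi * mesh_inner \<nu> e e"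
proof -
  obtain E ev a where E: "finite E" "E \<subseteq> H - {0}" "\<forall>v\<in>E. S v = ev v *\<^sub>R v"
    "\<forall>u\<in>E. \<forall>v\<in>E. u \<noteq> v \<longrightarrow> mesh_inner \<nu> u v = 0" "e = (\<Sum>v\<in>E. a v *\<^sub>R v)"
    using spectral_expansion[OF H S e] by blast
  have "S e = (\<Sum>v\<in>E. (a v * ev v) *\<^sub>R v)"
    using linear_operator_in_sum[of H S E a] E H S
    by (auto simp: euclidean_mesh_space_def symmetric_in_def)
  then have 1: "mesh_inner \<nu> (S e) e = (\<Sum>v\<in>E. ev v * ((a v)\<^sup>2 * mesh_inner \<nu> v v))"
    using mesh_inner_orthogonal_sum[OF E(1,4)] E(5)
    by (simp add: power2_eq_square mult_ac)
  have 2: "mesh_inner \<nu> e e = (\<Sum>v\<in>E. (a v)\<^sup>2 * mesh_inner \<nu> v v)"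
    using mesh_inner_orthogonal_sum[OF E(1,4)] E(5)
    by (simp add: power2_eq_square)
  have nn: "0 \<le> (a v)\<^sup>2 * mesh_inner \<nu> v v" and ev: "lo \<le> ev v \<and> ev v \<le> hi" if "v \<in> E" for v
    using that H E(2) eig[OF _ _ bspec[OF E(3) that]]
    by (auto simp: euclidean_mesh_space_def less_imp_le)
  show ?thesis
    unfolding 1 2 sum_distrib_left using nn ev by (auto intro!: sum_mono mult_right_mono)
qed

text \<open>
  The Richardson iteration with parameters \<open>\<theta>\<close> multiplies the component of \<open>e\<close> along an eigenvector
  with eigenvalue \<open>x\<close> by \<open>1 - \<theta> x\<close>. Because \<open>S\<close> and the iteration share an orthogonal eigenbasis, the
  same factor controls the norm and the energy norm. The energy needs \<open>0 \<le> lo\<close>, so that its terms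
  are nonnegative.
\<close>

lemma residual_polynomial_bound:
  assumes H: "euclidean_mesh_space \<nu> H" and S: "symmetric_in \<nu> H S"
    and rng: "\<And>v. v \<in> H \<Longrightarrow> lo * mesh_inner \<nu> v v \<le> mesh_inner \<nu> (S v) v"
      "\<And>v. v \<in> H \<Longrightarrow> mesh_inner \<nu> (S v) v \<le> hi * mesh_inner \<nu> v v"
    and lo: "0 \<le> lo" and e0: "e 0 \<in> H"
    and step: "\<And>l. l < N \<Longrightarrow> e (Suc l) = e l - \<theta> l *\<^sub>R S (e l)"
    and M: "\<And>x. lo \<le> x \<Longrightarrow> x \<le> hi \<Longrightarrow> \<bar>\<Prod>l<N. 1 - \<theta> l * x\<bar> \<le> M"
  shows "mesh_inner \<nu> (e N) (e N) \<le> M\<^sup>2 * mesh_inner \<nu> (e 0) (e 0)"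
    and "mesh_inner \<nu> (S (e N)) (e N) \<le> M\<^sup>2 * mesh_inner \<nu> (S (e 0)) (e 0)"
proof -
  have sub: "subspace H" and lin: "linear_operator_in H S"
    using H S by (auto simp: euclidean_mesh_space_def symmetric_in_def)
  obtain E ev a where E: "finite E" "E \<subseteq> H - {0}" "\<forall>v\<in>E. S v = ev v *\<^sub>R v"
    "\<forall>u\<in>E. \<forall>v\<in>E. u \<noteq> v \<longrightarrow> mesh_inner \<nu> u v = 0" "e 0 = (\<Sum>v\<in>E. a v *\<^sub>R v)"
    using spectral_expansion[OF H S e0] by blast
  have EH: "E \<subseteq> H" using E(2) by blast
  define p where "p k v = (\<Prod>l<k. 1 - \<theta> l * ev v)" for k v
  have S_exp: "S (\<Sum>v\<in>E. b v *\<^sub>R v) = (\<Sum>v\<in>E. (b v * ev v) *\<^sub>R v)" for b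
    using linear_operator_in_sum[OF lin sub E(1) EH] E(3) by simp
  have e_exp: "e k = (\<Sum>v\<in>E. (a v * p k v) *\<^sub>R v)" if "k \<le> N" for k
    using that
  proof (induction k)
    case 0
    then show ?case by (simp add: E(5) p_def)
  next
    case (Suc k)
    then have "e (Suc k) = e k - \<theta> k *\<^sub>R S (e k)" and "e k = (\<Sum>v\<in>E. (a v * p k v) *\<^sub>R v)"
      using step by auto
    then have "e (Suc k) = (\<Sum>v\<in>E. (a v * p k v) *\<^sub>R v - \<theta> k *\<^sub>R ((a v * p k v * ev v) *\<^sub>R v))"
      by (simp only: S_exp scaleR_sum_right sum_subtractf)
    also have "\<dots> = (\<Sum>v\<in>E. (a v * p (Suc k) v) *\<^sub>R v)"
    proof (intro sum.cong refl)
      fix v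
      have "a v * p k v - \<theta> k * (a v * p k v * ev v) = a v * p (Suc k) v"
        by (simp add: p_def algebra_simps)
      then show "(a v * p k v) *\<^sub>R v - \<theta> k *\<^sub>R ((a v * p k v * ev v) *\<^sub>R v) = (a v * p (Suc k) v) *\<^sub>R v"
        by (simp only: scaleR_scaleR scaleR_left_diff_distrib[symmetric])
    qed
    finally show ?case .
  qed
  have ee: "mesh_inner \<nu> (e k) (e k) = (\<Sum>v\<in>E. (p k v)\<^sup>2 * ((a v)\<^sup>2 * mesh_inner \<nu> v v))"
    and See: "mesh_inner \<nu> (S (e k)) (e k)
      = (\<Sum>v\<in>E. (p k v)\<^sup>2 * (ev v * ((a v)\<^sup>2 * mesh_inner \<nu> v v)))" if "k \<le> N" for k
    unfolding e_exp[OF that] S_exp mesh_inner_orthogonal_sum[OF E(1,4)]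
    by (rule sum.cong; simp add: power2_eq_square mult_ac)+
  have vpos: "0 < mesh_inner \<nu> v v" if "v \<in> E" for v
    using that H E(2) by (auto simp: euclidean_mesh_space_def)
  have spec: "lo \<le> ev v" "ev v \<le> hi" if "v \<in> E" for v
    using rng[of v] that EH bspec[OF E(3) that] vpos[OF that] by (auto simp: mesh_inner_bilinear)
  have p0: "p 0 v = 1" for v by (simp add: p_def)
  have pN: "(p N v)\<^sup>2 \<le> M\<^sup>2" if "v \<in> E" for v
    using M[OF spec[OF that]] by (intro power2_le_iff_abs_le[THEN iffD2]) (auto simp: p_def)
  show "mesh_inner \<nu> (e N) (e N) \<le> M\<^sup>2 * mesh_inner \<nu> (e 0) (e 0)"
    unfolding ee[OF order_refl] ee[OF le0] sum_distrib_left p0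
    using pN vpos by (auto intro!: sum_mono mult_right_mono simp: less_imp_le)
  show "mesh_inner \<nu> (S (e N)) (e N) \<le> M\<^sup>2 * mesh_inner \<nu> (S (e 0)) (e 0)"
    unfolding See[OF order_refl] See[OF le0] sum_distrib_left p0
    using pN vpos spec lo by (auto intro!: sum_mono mult_right_mono mult_nonneg_nonneg simp: less_imp_le order_trans[OF lo])
qed


section \<open>The quotient of commuting positive operators\<close>

lemma selfadjoint_pos_bij:
  assumes H: "euclidean_mesh_space \<mu> H" and C: "selfadjoint_pos \<mu> H C"
  shows "bij_betw C H H"
proof -
  have sub: "subspace H" and lin: "linear_operator_in H C"
    using H C by (auto simp: euclidean_mesh_space_def selfadjoint_pos_def)
  obtain F where F: "linear F" and FC: "\<And>v. v \<in> H \<Longrightarrow> F v = C v"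
    using linear_operator_in_extend[OF sub lin] by blast
  have inj: "inj_on F H"
  proof (rule inj_onI)
    fix u v assume uv: "u \<in> H" "v \<in> H" "F u = F v"
    then have d: "u - v \<in> H" using sub by (simp add: subspace_diff)
    then have "C (u - v) = 0"
      using uv FC[OF d] by (simp add: linear_diff[OF F])
    then have "\<not> 0 < mesh_inner \<mu> (C (u - v)) (u - v)"
      by (simp add: mesh_inner_zero_left)
    then show "u = v"
      using C d unfolding selfadjoint_pos_def by auto
  qed
  have "F ` H \<subseteq> H"
    using lin FC by (auto simp: linear_operator_in_def)
  moreover have "dim (F ` H) = dim H"
    using F inj sub by (intro dim_image_eq) (simp_all add: span_eq_iff[THEN iffD2])
  ultimately have "F ` H = H"
    using sub F by (intro subspace_dim_equal) (auto intro: linear_subspace_image)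
  then have "bij_betw F H H"
    using inj by (simp add: bij_betw_def)
  then show ?thesis
    using bij_betw_cong[of H F C H] FC by blast
qed

lemma linear_operator_in_inv_into:
  assumes sub: "subspace H" and B: "linear_operator_in H B" and bij: "bij_betw B H H"
  shows "linear_operator_in H (inv_into H B)"
proof -
  let ?B' = "inv_into H B"
  have mem: "?B' v \<in> H" and right: "B (?B' v) = v" if "v \<in> H" for v
    using bij_betwE[OF bij_betw_inv_into[OF bij]] bij_betw_inv_into_right[OF bij] that by auto
  have left: "?B' (B v) = v" if "v \<in> H" for v
    using bij that by (simp add: bij_betw_inv_into_left)
  have "?B' (u + v) = ?B' u + ?B' v" if "u \<in> H" "v \<in> H" for u v
  proof -
    have "B (?B' u + ?B' v) = u + v"
      using B mem right that by (simp add: linear_operator_in_def)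
    then show ?thesis
      using left[of "?B' u + ?B' v"] mem that sub by (simp add: subspace_add)
  qed
  moreover have "?B' (c *\<^sub>R v) = c *\<^sub>R ?B' v" if "v \<in> H" for c v
  proof -
    have "B (c *\<^sub>R ?B' v) = c *\<^sub>R v"
      using B mem right that by (simp add: linear_operator_in_def)
    then show ?thesis
      using left[of "c *\<^sub>R ?B' v"] mem that sub by (simp add: subspace_scale)
  qed
  ultimately show ?thesis
    using mem by (simp add: linear_operator_in_def)
qed

text \<open>
  Commutation passes from \<open>B\<close> to its inverse, which makes \<open>K = B\<^sup>-\<^sup>1 A\<close> symmetric. The comparison of \<open>A\<close>
  with \<open>B\<close> says nothing directly about the form of \<open>K\<close>, but on an eigenvector \<open>K v = c v\<close> it reads
  \<open>A v = c B v\<close>, so that \<open>c\<close> is the ratio of the forms of \<open>A\<close> and \<open>B\<close> at \<open>v\<close>. The spectral theorem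
  then gives the bound on all of \<open>H\<close>, without a square root of \<open>B\<close>.
\<close>

lemma
  assumes H: "euclidean_mesh_space \<mu> H" and A: "selfadjoint_pos \<mu> H A" and B: "selfadjoint_pos \<mu> H B"
    and comm: "\<forall>v\<in>H. A (B v) = B (A v)" and le: "operator_le \<mu> H A (\<lambda>v. k *\<^sub>R B v)"
  shows symmetric_in_commuting_quotient: "symmetric_in \<mu> H (\<lambda>v. inv_into H B (A v))"
    and commuting_quotient_bounds: "v \<in> H \<Longrightarrow> 0 \<le> mesh_inner \<mu> (inv_into H B (A v)) v \<and>
      mesh_inner \<mu> (inv_into H B (A v)) v \<le> k * mesh_inner \<mu> v v"
proof -
  define K where "K = (\<lambda>v. inv_into H B (A v))"
  have sub: "subspace H" and linA: "linear_operator_in H A" and linB: "linear_operator_in H B"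
    using H A B by (auto simp: euclidean_mesh_space_def selfadjoint_pos_def)
  have AH: "A v \<in> H" if "v \<in> H" for v
    using linA that by (simp add: linear_operator_in_def)
  have bij: "bij_betw B H H"
    by (rule selfadjoint_pos_bij[OF H B])
  have mem: "inv_into H B v \<in> H" and right: "B (inv_into H B v) = v" if "v \<in> H" for v
    using bij_betwE[OF bij_betw_inv_into[OF bij]] bij_betw_inv_into_right[OF bij] that by auto
  have left: "inv_into H B (B v) = v" if "v \<in> H" for v
    using bij that by (simp add: bij_betw_inv_into_left)
  have linB': "linear_operator_in H (inv_into H B)"
    by (rule linear_operator_in_inv_into[OF sub linB bij])
  have AB': "A (inv_into H B v) = inv_into H B (A v)" if "v \<in> H" for v
    using comm left right mem AH that by metis
  have BK: "B (K v) = A v" if "v \<in> H" for v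
    using right AH that by (simp add: K_def)
  have symA: "mesh_inner \<mu> (A u) v = mesh_inner \<mu> u (A v)"
    and symB: "mesh_inner \<mu> (B u) v = mesh_inner \<mu> u (B v)" if "u \<in> H" "v \<in> H" for u v
    using A B that by (auto simp: selfadjoint_pos_def)
  have sym: "mesh_inner \<mu> (K u) v = mesh_inner \<mu> u (K v)" if "u \<in> H" "v \<in> H" for u v
  proof -
    have "mesh_inner \<mu> (K u) v = mesh_inner \<mu> (B (K u)) (inv_into H B v)"
      using symB[of "K u" "inv_into H B v"] mem right AH that by (simp add: K_def)
    also have "\<dots> = mesh_inner \<mu> u (A (inv_into H B v))"
      using BK symA mem that by simp
    finally show ?thesis
      using AB' that by (simp add: K_def)
  qed
  have "linear_operator_in H K"
    using linA linB' by (simp add: linear_operator_in_def K_def)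
  then have symK: "symmetric_in \<mu> H K"
    using sym by (simp add: symmetric_in_def)
  then show "symmetric_in \<mu> H (\<lambda>v. inv_into H B (A v))"
    by (simp add: K_def)
  have "0 \<le> c \<and> c \<le> k" if v: "v \<in> H" "v \<noteq> 0" and eig: "K v = c *\<^sub>R v" for v c
  proof -
    have "A v = c *\<^sub>R B v"
      using BK[OF v(1)] eig linB v by (simp add: linear_operator_in_def)
    then have Av: "mesh_inner \<mu> (A v) v = c * mesh_inner \<mu> (B v) v"
      by (simp add: mesh_inner_bilinear)
    have pos: "0 < mesh_inner \<mu> (A v) v" "0 < mesh_inner \<mu> (B v) v"
      using A B v by (auto simp: selfadjoint_pos_def)
    have "c * mesh_inner \<mu> (B v) v \<le> k * mesh_inner \<mu> (B v) v"
      using le v Av by (auto simp: operator_le_def mesh_inner_bilinear)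
    then show ?thesis
      using pos Av by (simp add: zero_less_mult_iff)
  qed
  then show "0 \<le> mesh_inner \<mu> (inv_into H B (A v)) v \<and>
      mesh_inner \<mu> (inv_into H B (A v)) v \<le> k * mesh_inner \<mu> v v" if "v \<in> H"
    using form_bounds_from_eigenvalues[OF H symK that, of 0 k] by (simp add: K_def)
qed

section \<open>Multiplication by the density\<close>

lemma mesh_inner_weighted:
  "mesh_inner (\<lambda>i. \<mu> i * \<rho> i) u v = mesh_inner \<mu> (pointwise_mult \<rho> u) v"
  by (simp add: mesh_inner_def pointwise_mult_def mult_ac)

lemma pointwise_mult_add: "pointwise_mult f (u + v) = pointwise_mult f u + pointwise_mult f v"
  by (simp add: pointwise_mult_def vec_eq_iff algebra_simps)

lemma pointwise_mult_scaleR: "pointwise_mult f (c *\<^sub>R v) = c *\<^sub>R pointwise_mult f v"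
  by (simp add: pointwise_mult_def vec_eq_iff)

lemma mesh_inner_ge_weighted:
  assumes "\<And>i. 0 \<le> \<mu> i" "\<And>i. r \<le> \<rho> i"
  shows "r * mesh_inner \<mu> v v \<le> mesh_inner (\<lambda>i. \<mu> i * \<rho> i) v v"
  unfolding mesh_inner_def sum_distrib_left
proof (intro sum_mono)
  fix i
  have "r * (\<mu> i * (v $ i)\<^sup>2) \<le> \<rho> i * (\<mu> i * (v $ i)\<^sup>2)"
    using assms by (intro mult_right_mono) auto
  then show "r * (\<mu> i * v $ i * v $ i) \<le> \<mu> i * \<rho> i * v $ i * v $ i"
    by (simp add: power2_eq_square mult_ac)
qed

lemma euclidean_mesh_space_weighted:
  assumes H: "euclidean_mesh_space \<mu> H" and r: "0 < r" "\<And>i. r \<le> \<rho> i"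
  shows "euclidean_mesh_space (\<lambda>i. \<mu> i * \<rho> i) H"
proof -
  have "0 < mesh_inner (\<lambda>i. \<mu> i * \<rho> i) v v" if "v \<in> H" "v \<noteq> 0" for v
    using mesh_inner_ge_weighted[of \<mu> r \<rho> v] H r that
    by (auto simp: euclidean_mesh_space_def intro: less_le_trans[OF mult_pos_pos])
  moreover have "0 \<le> \<rho> i" for i
    using r(1) r(2)[of i] by linarith
  ultimately show ?thesis
    using H by (auto simp: euclidean_mesh_space_def)
qed

text \<open>
  Only invariance of \<open>H\<close> under multiplication by \<open>\<rho>\<close> is given. This multiplication is a positive
  self-adjoint operator in \<open>H\<close>, hence a bijection of the finite-dimensional space \<open>H\<close>, so the
  division by \<open>\<rho>\<close> preserves \<open>H\<close> as well.
\<close>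

lemma pointwise_mult_inverse_mem:
  assumes H: "euclidean_mesh_space \<mu> H" and r: "0 < r" "\<And>i. r \<le> \<rho> i"
    and mult: "\<forall>v\<in>H. pointwise_mult \<rho> v \<in> H" and v: "v \<in> H"
  shows "pointwise_mult (\<lambda>i. 1 / \<rho> i) v \<in> H"
proof -
  have "selfadjoint_pos \<mu> H (pointwise_mult \<rho>)"
    using euclidean_mesh_space_weighted[OF H r] mult
    by (auto simp: selfadjoint_pos_def linear_operator_in_def pointwise_mult_add
        pointwise_mult_scaleR euclidean_mesh_space_def mesh_inner_weighted[symmetric])
      (auto simp: mesh_inner_def pointwise_mult_def mult_ac)
  then obtain u where "u \<in> H" "v = pointwise_mult \<rho> u"
    using selfadjoint_pos_bij[OF H] v by (metis bij_betw_imp_surj_on imageE)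
  moreover have "\<rho> i \<noteq> 0" for i
    using r(1) r(2)[of i] by linarith
  ultimately show ?thesis
    by (simp add: pointwise_mult_def)
qed

section \<open>Chebyshev polynomials and the optimal residual\<close>

fun cheb_poly :: "nat \<Rightarrow> real poly" where
  "cheb_poly 0 = 1"
| "cheb_poly (Suc 0) = [:0, 1:]"
| "cheb_poly (Suc (Suc n)) = [:0, 2:] * cheb_poly (Suc n) - cheb_poly n"

lemma degree_cheb_poly: "degree (cheb_poly n) \<le> n"
proof (induction n rule: cheb_poly.induct)
  case (3 n)
  have "degree ([:0, 2:] * cheb_poly (Suc n)) \<le> Suc (Suc n)"
    using degree_mult_le[of "[:0, 2::real:]" "cheb_poly (Suc n)"] 3 by simp
  then show ?case
    using 3 by (simp add: degree_diff_le)
qed auto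

lemma cheb_poly_cos: "poly (cheb_poly n) (cos t) = cos (real n * t)"
proof (induction n rule: cheb_poly.induct)
  case (3 n)
  have "cos (real (Suc (Suc n)) * t) + cos (real n * t) = 2 * cos t * cos (real (Suc n) * t)"
    using cos_plus_cos[of "real (Suc (Suc n)) * t" "real n * t"]
    by (simp add: algebra_simps add_divide_distrib diff_divide_distrib)
  then show ?case
    using 3 by (simp add: algebra_simps)
qed auto

text \<open>
  The counterpart of the cosine formula off the interval \<open>[-1, 1]\<close>, where \<open>u + 1 / u\<close> plays the role
  of \<open>2 cos t\<close>.
\<close>

lemma cheb_poly_joukowski:
  assumes "u \<noteq> 0"
  shows "poly (cheb_poly n) ((u + 1 / u) / 2) = (u ^ n + 1 / u ^ n) / 2"
proof (induction n rule: cheb_poly.induct)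
  case (3 n)
  have "2 * ((u + 1 / u) / 2) * ((u ^ Suc n + 1 / u ^ Suc n) / 2) - (u ^ n + 1 / u ^ n) / 2
      = (u ^ Suc (Suc n) + 1 / u ^ Suc (Suc n)) / 2"
    using assms by (simp add: divide_simps) (simp add: algebra_simps)
  moreover have "poly (cheb_poly (Suc (Suc n))) x
      = 2 * x * poly (cheb_poly (Suc n)) x - poly (cheb_poly n) x" for x
    by (simp add: algebra_simps)
  ultimately show ?case
    by (simp only: 3)
qed (use assms in auto)

lemma abs_cheb_poly_le_1:
  assumes "\<bar>y\<bar> \<le> 1"
  shows "\<bar>poly (cheb_poly n) y\<bar> \<le> 1"
  using cheb_poly_cos[of n "arccos y"] assms by (simp add: cos_arccos_abs)

lemma cheb_poly_root:
  assumes "l < N"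
  shows "poly (cheb_poly N) (- cos (pi * (real l + 1/2) / real N)) = 0"
proof -
  define t where "t = pi * (real l + 1/2) / real N"
  have "real N * (pi - t) = real N * pi - (real l * pi + pi / 2)"
    using assms by (simp add: t_def field_simps)
  then have "cos (real N * (pi - t)) = 0"
    by (simp add: cos_diff sin_add cos_add)
  moreover have "- cos t = cos (pi - t)" by simp
  ultimately show ?thesis
    using cheb_poly_cos[of N "pi - t"] unfolding t_def by simp
qed

text \<open>
  The numbers \<open>- c l\<close> are the \<open>N\<close> distinct roots of \<open>T\<^sub>N\<close>, so \<open>T\<^sub>N\<close> is a multiple of the product of
  the \<open>x + c l\<close>. The ratio of two values does not see the leading coefficient, so it suffices to
  choose the factor that fits at \<open>z\<close> and to count: two polynomials of degree at most \<open>N\<close> agree at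
  the \<open>N\<close> roots and at \<open>z\<close>, which is not a root because it exceeds \<open>1\<close>.
\<close>

lemma cheb_poly_ratio:
  assumes z: "1 < z" and Tz: "poly (cheb_poly N) z \<noteq> 0"
  defines "c \<equiv> \<lambda>l. cos (pi * (real l + 1/2) / real N)"
  shows "(\<Prod>l<N. (y + c l) / (z + c l)) = poly (cheb_poly N) y / poly (cheb_poly N) z"
proof -
  define Q where "Q = (\<Prod>l<N. [:c l, 1:])"
  have Q: "poly Q x = (\<Prod>l<N. x + c l)" for x
    by (simp add: Q_def poly_prod add.commute)
  have c_ge: "-1 \<le> c l" for l by (simp add: c_def)
  then have zc: "0 < z + c l" for l
    using z by (smt (verit))
  have Qz: "poly Q z \<noteq> 0"
    unfolding Q using zc by (smt (verit) prod_zero_iff finite_lessThan)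
  define k where "k = poly (cheb_poly N) z / poly Q z"
  let ?X = "insert z ((\<lambda>l. - c l) ` {..<N})"
  have inj: "inj_on (\<lambda>l. - c l) {..<N}"
  proof (rule inj_onI)
    fix i j assume ij: "i \<in> {..<N}" "j \<in> {..<N}" "- c i = - c j"
    have rng: "0 \<le> pi * (real l + 1/2) / real N \<and> pi * (real l + 1/2) / real N \<le> pi" if "l < N" for l
      using that by (auto simp: divide_le_eq intro!: divide_nonneg_nonneg mult_left_mono)
    have "c i = c j" using ij(3) by (simp only: neg_equal_iff_equal)
    then have "pi * (real i + 1/2) / real N = pi * (real j + 1/2) / real N"
      using rng[of i] rng[of j] ij(1,2) unfolding c_def lessThan_iff by (blast intro: cos_inj_pi)
    moreover have "real N \<noteq> 0" using ij(1) by auto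
    ultimately have "pi * (real i + 1/2) = pi * (real j + 1/2)"
      by (metis nonzero_eq_divide_eq nonzero_mult_div_cancel_right)
    then show "i = j" by simp
  qed
  have "z \<notin> (\<lambda>l. - c l) ` {..<N}"
    using z c_ge by (smt (verit) imageE)
  then have card: "card ?X = Suc N"
    using card_image[OF inj] by simp
  have "cheb_poly N = smult k Q"
  proof (rule poly_eqI_degree[where A = ?X])
    show "card ?X > degree (cheb_poly N)"
      using degree_cheb_poly[of N] card by simp
    have "degree Q \<le> N"
      unfolding Q_def using degree_prod_sum_le[of "{..<N}" "\<lambda>l. [:c l, 1:]"] by simp
    then show "card ?X > degree (smult k Q)"
      using card degree_smult_le[of k Q] by linarith
    fix x assume "x \<in> ?X"
    then consider "x = z" | l where "l < N" "x = - c l" by auto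
    then show "poly (cheb_poly N) x = poly (smult k Q) x"
    proof cases
      case 1
      then show ?thesis using Qz by (simp add: k_def)
    next
      case 2
      then have "poly Q x = 0" by (auto simp: Q)
      then show ?thesis using 2 cheb_poly_root[OF 2(1)] by (simp add: c_def)
    qed
  qed
  then have "poly (cheb_poly N) y / poly (cheb_poly N) z = poly Q y / poly Q z"
    using Tz by auto
  then show ?thesis
    by (simp add: Q prod_dividef)
qed

lemma q1_q0_relations:
  assumes "0 \<le> s" "s < 1"
  shows "0 < q1 s" "0 < q0 s" "q0 s < 1" "(q1 s + 1 / q1 s) / 2 = 1 / q0 s"
    "q1 s = (1 - s) / (5 - s + 4 * sqrt (1 + 1/2 * (1 - s)))"
proof -
  \<comment> \<open>In terms of \<open>r\<close>, all the quantities are rational functions.\<close>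
  define r where "r = sqrt (lambda_bar s)"
  have L: "lambda_bar s > 1" using assms by (simp add: lambda_bar_def)
  have r: "r > 1" "r\<^sup>2 = lambda_bar s"
    using L by (auto simp: r_def)
  have q1: "q1 s = (r - 1) / (r + 1)" by (simp add: q1_def r_def)
  have q0: "q0 s = (r\<^sup>2 - 1) / (r\<^sup>2 + 1)" by (simp add: q0_def r)
  have r21: "r\<^sup>2 > 1" using L r by simp
  show "0 < q1 s" using r by (simp add: q1)
  show "0 < q0 s" "q0 s < 1" using r21 by (simp_all add: q0)
  have fac: "r\<^sup>2 - 1 = (r - 1) * (r + 1)" by (simp add: power2_eq_square algebra_simps)
  have "(q1 s + 1 / q1 s) / 2 = ((r - 1)\<^sup>2 + (r + 1)\<^sup>2) / (2 * ((r - 1) * (r + 1)))"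
    unfolding q1 using r by (simp add: divide_simps power2_eq_square)
  also have "\<dots> = (2 * (r\<^sup>2 + 1)) / (2 * (r\<^sup>2 - 1))"
    unfolding fac[symmetric] by (simp add: power2_eq_square algebra_simps)
  also have "\<dots> = 1 / q0 s" unfolding q0 by (subst mult_divide_mult_cancel_left) auto
  finally show "(q1 s + 1 / q1 s) / 2 = 1 / q0 s" .
  have s: "s = 3 - 2 * r\<^sup>2" using r(2) by (simp add: lambda_bar_def field_simps)
  have r': "sqrt (1 + 1/2 * (1 - s)) = r" by (simp add: r_def lambda_bar_def)
  have "(1 - s) / (5 - s + 4 * r) = (2 * (r - 1) * (r + 1)) / (2 * (r + 1) * (r + 1))"
    by (simp add: s power2_eq_square algebra_simps)
  also have "\<dots> = q1 s" using r(1) unfolding q1 by (simp add: divide_simps) (simp add: algebra_simps)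
  finally show "q1 s = (1 - s) / (5 - s + 4 * sqrt (1 + 1/2 * (1 - s)))"
    unfolding r' by simp
qed

lemma q1_le:
  assumes "0 \<le> s" "s < 1"
  shows "q1 s \<le> 1 / (5 + 4 * sqrt (15/10))"
proof -
  have mono: "(x - 1) / (x + 1) \<le> (y - 1) / (y + 1)" if "1 \<le> x" "x \<le> y" for x y :: real
    using that by (simp add: divide_simps) (simp add: algebra_simps)
  have "q1 s \<le> q1 0"
    unfolding q1_def using assms by (intro mono) (simp_all add: lambda_bar_def)
  also have "q1 0 = 1 / (5 + 4 * sqrt (15/10))"
    using q1_q0_relations(5)[of 0] by simp
  finally show ?thesis .
qed

lemma q1_numeric: "\<bar>1 / (5 + 4 * sqrt (15/10)) - 1010/10000\<bar> \<le> (5/100000 :: real)"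
proof -
  have "1.2247 \<le> sqrt (15/10)" by (rule real_le_rsqrt) (simp add: power2_eq_square)
  moreover have "sqrt (15/10) \<le> 1.225" by (rule real_le_lsqrt) (simp_all add: power2_eq_square)
  ultimately have "1 / (5 + 4 * sqrt (15/10)) \<le> 1 / 9.8988" "1 / 9.9 \<le> 1 / (5 + 4 * sqrt (15/10))"
    by (intro divide_left_mono; simp)+
  then show ?thesis by (simp add: abs_le_iff)
qed

text \<open>
  The affine map \<open>x \<mapsto> y = (1 - theta_opt x) / q0\<close> takes the spectral interval onto \<open>[-1, 1]\<close>, and
  the point \<open>x = 0\<close> to \<open>z = 1 / q0\<close>. With it, each factor \<open>1 - \<theta> x\<close> becomes \<open>(y + c) / (z + c)\<close>, where
  \<open>c\<close> is the cosine in the parameter \<open>\<theta>\<close>.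
\<close>

lemma chebyshev_residual_bound:
  assumes s: "0 \<le> s" "s < 1" and x: "1 \<le> x" "x \<le> lambda_bar s"
  shows "\<bar>\<Prod>l<N. 1 - cheb_theta s N l * x\<bar> \<le> 2 * q1 s ^ N / (1 + q1 s ^ (2 * N))"
proof -
  note q = q1_q0_relations[OF s]
  define z where "z = 1 / q0 s"
  define y where "y = (1 - theta_opt s * x) / q0 s"
  define T where "T = poly (cheb_poly N)"
  have z: "1 < z" using q by (simp add: z_def)
  have Tz: "T z = (1 + q1 s ^ (2 * N)) / (2 * q1 s ^ N)"
  proof -
    define Q where "Q = q1 s ^ N"
    have "q1 s ^ (2 * N) = Q * Q" by (simp add: Q_def mult_2 power_add)
    moreover have "0 < Q" using q(1) by (simp add: Q_def)
    moreover have "T z = (Q + 1 / Q) / 2"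
      using cheb_poly_joukowski[of "q1 s" N] q(1) by (simp add: T_def z_def Q_def q(4))
    ultimately show ?thesis
      unfolding Q_def[symmetric] by (simp add: field_simps)
  qed
  have Tzpos: "0 < T z"
    unfolding Tz using q(1) by (intro divide_pos_pos add_pos_pos) auto
  have "1 - cheb_theta s N l * x
      = (y + cos (pi * (real l + 1/2) / real N)) / (z + cos (pi * (real l + 1/2) / real N))" for l
  proof -
    define c where "c = cos (pi * (real l + 1/2) / real N)"
    have "-1 \<le> c" by (simp add: c_def)
    then have "z + c > 0" using z by linarith
    then have "1 + q0 s * c > 0"
      using q(2) by (simp add: z_def divide_simps mult.commute split: if_splits)
    moreover have "y + c = (1 + q0 s * c - theta_opt s * x) / q0 s"
       "z + c = (1 + q0 s * c) / q0 s"
      using q(2) by (auto simp: y_def z_def field_simps)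
    moreover have "(a / q0 s) / (d / q0 s) = a / d" for a d
      using q(2) by simp
    ultimately have "(y + c) / (z + c) = (1 + q0 s * c - theta_opt s * x) / (1 + q0 s * c)"
      by (simp only:)
    then show ?thesis
      using \<open>1 + q0 s * c > 0\<close> unfolding cheb_theta_def c_def[symmetric]
      by (simp add: diff_divide_distrib)
  qed
  then have "(\<Prod>l<N. 1 - cheb_theta s N l * x) = T y / T z"
    using cheb_poly_ratio[OF z, of N y] Tzpos by (simp add: T_def)
  moreover have "\<bar>T y\<bar> \<le> 1"
  proof -
    have L: "lambda_bar s > 1" using s by (simp add: lambda_bar_def)
    have "y = (lambda_bar s + 1 - 2 * x) / (lambda_bar s - 1)"
      using L by (simp add: y_def theta_opt_def q0_def divide_simps) (simp add: algebra_simps)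
    then have "\<bar>y\<bar> \<le> 1"
      using L x by (simp add: abs_le_iff divide_le_eq minus_divide_left)
    then show ?thesis
      unfolding T_def by (rule abs_cheb_poly_le_1)
  qed
  ultimately have "\<bar>\<Prod>l<N. 1 - cheb_theta s N l * x\<bar> \<le> 1 / T z"
    using Tzpos by (simp add: abs_divide divide_right_mono)
  then show ?thesis by (simp add: Tz)
qed

section \<open>The error equation of the iterative method\<close>

text \<open>
  This is \<open>I + (h\<^sup>2 / 12) \<rho>\<^sup>-\<^sup>1 B\<^sup>-\<^sup>1 A\<close>. Keeping the factor \<open>\<rho>\<^sup>-\<^sup>1\<close> outside identifies the energy norm
  with the form of this operator for the weights \<open>\<mu> \<rho>\<close>.
\<close>

definition normalized_operator ::
  "(real ^ 'n::finite) set \<Rightarrow> ('n \<Rightarrow> real) \<Rightarrow> real \<Rightarrow> (real ^ 'n \<Rightarrow> real ^ 'n) \<Rightarrow> (real ^ 'n \<Rightarrow> real ^ 'n)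
   \<Rightarrow> real ^ 'n \<Rightarrow> real ^ 'n" where
  "normalized_operator H \<rho> ht A B v = pointwise_mult (\<lambda>i. 1 / \<rho> i) (op_A_bold H \<rho> ht A B v)"

lemma mesh_inner_normalized_operator:
  assumes "\<And>i. \<rho> i \<noteq> 0"
  shows "mesh_inner (\<lambda>i. \<mu> i * \<rho> i) (normalized_operator H \<rho> ht A B u) v
    = mesh_inner \<mu> (op_A_bold H \<rho> ht A B u) v"
  using assms by (simp add: mesh_inner_def normalized_operator_def pointwise_mult_def)

text \<open>
  The weights \<open>\<mu> \<rho>\<close> cancel the factor \<open>1 / \<rho>\<close> in the operator: its form is the weighted square
  norm plus \<open>h\<^sup>2 / 12\<close> times the form of \<open>B\<^sup>-\<^sup>1 A\<close> for the weights \<open>\<mu>\<close>. The second summand is symmetric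
  and nonnegative. It is at most \<open>(1 - s) r / 2\<close> times the square norm for the weights \<open>\<mu>\<close>, and the
  lower bound \<open>r\<close> of \<open>\<rho>\<close> is absorbed in passing to the weights \<open>\<mu> \<rho>\<close>.
\<close>

lemma normalized_operator_spectrum:
  assumes H: "euclidean_mesh_space \<mu> H" and A: "selfadjoint_pos \<mu> H A" and B: "selfadjoint_pos \<mu> H B"
    and comm: "\<forall>v\<in>H. A (B v) = B (A v)" and le: "operator_le \<mu> H A (\<lambda>v. k *\<^sub>R B v)"
    and r: "0 < r" "\<And>i. r \<le> \<rho> i" and mult: "\<forall>v\<in>H. pointwise_mult \<rho> v \<in> H"
    and s: "s \<le> 1" and step_bound: "1/6 * ht\<^sup>2 * k \<le> (1 - s) * r"
  shows "symmetric_in (\<lambda>i. \<mu> i * \<rho> i) H (normalized_operator H \<rho> ht A B)" (is ?sym)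
    and "v \<in> H \<Longrightarrow> mesh_inner (\<lambda>i. \<mu> i * \<rho> i) v v
        \<le> mesh_inner (\<lambda>i. \<mu> i * \<rho> i) (normalized_operator H \<rho> ht A B v) v" (is "_ \<Longrightarrow> ?lower")
    and "v \<in> H \<Longrightarrow> mesh_inner (\<lambda>i. \<mu> i * \<rho> i) (normalized_operator H \<rho> ht A B v) v
        \<le> lambda_bar s * mesh_inner (\<lambda>i. \<mu> i * \<rho> i) v v" (is "_ \<Longrightarrow> ?upper")
proof -
  define \<nu> where "\<nu> = (\<lambda>i. \<mu> i * \<rho> i)"
  define K where "K = (\<lambda>v. inv_into H B (A v))"
  define S where "S = normalized_operator H \<rho> ht A B"
  have \<rho>0: "\<rho> i \<noteq> 0" for i using r(1) r(2)[of i] by linarith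
  have sub: "subspace H" and \<mu>: "\<And>i. 0 \<le> \<mu> i"
    using H by (auto simp: euclidean_mesh_space_def)
  have K: "symmetric_in \<mu> H K"
    unfolding K_def by (rule symmetric_in_commuting_quotient[OF H A B comm le])
  have Kbounds: "0 \<le> mesh_inner \<mu> (K v) v" "mesh_inner \<mu> (K v) v \<le> k * mesh_inner \<mu> v v"
    if "v \<in> H" for v
    using commuting_quotient_bounds[OF H A B comm le that] by (simp_all add: K_def)
  have Abold: "op_A_bold H \<rho> ht A B v = pointwise_mult \<rho> v + (1/12 * ht\<^sup>2) *\<^sub>R K v" for v
    by (simp add: op_A_bold_def K_def)
  have KH: "K v \<in> H" and Kadd: "K (u + v) = K u + K v" and Kscale: "K (c *\<^sub>R v) = c *\<^sub>R K v"
    if "u \<in> H" "v \<in> H" for u v c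
    using K that by (simp_all add: symmetric_in_def linear_operator_in_def)
  have SH: "S v \<in> H" if "v \<in> H" for v
    unfolding S_def normalized_operator_def Abold
    using mult that KH sub
    by (intro pointwise_mult_inverse_mem[OF H r mult] subspace_add subspace_scale) auto
  have lin: "linear_operator_in H S"
    unfolding linear_operator_in_def
  proof (intro conjI ballI allI)
    show "S (u + v) = S u + S v" if "u \<in> H" "v \<in> H" for u v
      unfolding S_def normalized_operator_def Abold Kadd[OF that]
      by (simp add: pointwise_mult_add pointwise_mult_scaleR scaleR_add_right)
    show "S (c *\<^sub>R v) = c *\<^sub>R S v" if "v \<in> H" for c v
      unfolding S_def normalized_operator_def Abold Kscale[OF that that]
      by (simp add: pointwise_mult_add pointwise_mult_scaleR scaleR_add_right)
  qed (rule SH)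
  have form: "mesh_inner \<nu> (S u) v = mesh_inner \<nu> u v + 1/12 * ht\<^sup>2 * mesh_inner \<mu> (K u) v" for u v
    unfolding \<nu>_def S_def mesh_inner_normalized_operator[OF \<rho>0] Abold
    by (simp add: mesh_inner_bilinear mesh_inner_weighted)
  have "mesh_inner \<nu> (S u) v = mesh_inner \<nu> u (S v)" if "u \<in> H" "v \<in> H" for u v
  proof -
    have "mesh_inner \<mu> (K u) v = mesh_inner \<mu> (K v) u"
      using K that by (simp add: symmetric_in_def mesh_inner_commute[of \<mu> u])
    then have "mesh_inner \<nu> (S u) v = mesh_inner \<nu> (S v) u"
      unfolding form by (simp add: mesh_inner_commute[of \<nu> u])
    then show ?thesis by (simp add: mesh_inner_commute[of \<nu> u])
  qed
  then show ?sym
    using lin by (simp add: symmetric_in_def S_def \<nu>_def)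
  show ?lower if "v \<in> H"
    using Kbounds(1)[OF that] form[of v v] by (simp add: S_def \<nu>_def)
  show ?upper if "v \<in> H"
  proof -
    have vv: "0 \<le> mesh_inner \<mu> v v"
      unfolding mesh_inner_def by (intro sum_nonneg) (simp add: mult.assoc \<mu>)
    have "1/12 * ht\<^sup>2 * mesh_inner \<mu> (K v) v \<le> 1/12 * ht\<^sup>2 * (k * mesh_inner \<mu> v v)"
      using Kbounds(2)[OF that] by (intro mult_left_mono) auto
    also have "\<dots> = 1/2 * (1/6 * ht\<^sup>2 * k) * mesh_inner \<mu> v v" by simp
    also have "\<dots> \<le> 1/2 * ((1 - s) * r) * mesh_inner \<mu> v v"
      using step_bound vv by (intro mult_right_mono mult_left_mono) auto
    also have "\<dots> = 1/2 * (1 - s) * (r * mesh_inner \<mu> v v)" by simp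
    also have "\<dots> \<le> 1/2 * (1 - s) * mesh_inner \<nu> v v"
      unfolding \<nu>_def using s mesh_inner_ge_weighted[OF \<mu> r(2)] by (intro mult_left_mono) auto
    finally show ?thesis
      using form[of v v] by (simp add: S_def \<nu>_def lambda_bar_def algebra_simps)
  qed
qed

text \<open>
  The solution \<open>w\<close> is a fixed point of every step, whatever \<open>\<theta>\<close> is, because \<open>b\<close> is \<open>B (\<rho> w)\<close> plus the
  term with \<open>A w\<close>. Hence the step acts linearly on the error.
\<close>

lemma cheb_step_error:
  assumes H: "euclidean_mesh_space \<mu> H" and A: "linear_operator_in H A" and B: "selfadjoint_pos \<mu> H B"
    and \<rho>0: "\<And>i. \<rho> i \<noteq> 0" and mult: "pointwise_mult \<rho> w \<in> H"
    and w: "w \<in> H" and eq: "B (pointwise_mult \<rho> w) + (1/12 * ht\<^sup>2) *\<^sub>R A w = b"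
    and v: "v \<in> H"
  shows "w - cheb_step H \<rho> ht A B b \<theta> v = (w - v) - \<theta> *\<^sub>R normalized_operator H \<rho> ht A B (w - v)"
proof -
  let ?B' = "inv_into H B" and ?c = "1/12 * ht\<^sup>2" and ?e = "w - v"
  have sub: "subspace H" and linB: "linear_operator_in H B"
    using H B by (auto simp: euclidean_mesh_space_def selfadjoint_pos_def)
  have bij: "bij_betw B H H"
    by (rule selfadjoint_pos_bij[OF H B])
  have eH: "?e \<in> H" and AeH: "A ?e \<in> H"
    using w v sub A by (simp_all add: subspace_diff linear_operator_in_def)
  have AeB'H: "?B' (A ?e) \<in> H"
    using bij_betwE[OF bij_betw_inv_into[OF bij]] AeH by blast
  have "v + ?e = w" by simp
  then have Aw: "A w = A v + A ?e"
    using A v eH unfolding linear_operator_in_def by metis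
  have "?c *\<^sub>R A v - b = - (?c *\<^sub>R A ?e) - B (pointwise_mult \<rho> w)"
    unfolding eq[symmetric] Aw by (simp add: scaleR_add_right)
  also have "\<dots> = B ((- ?c) *\<^sub>R ?B' (A ?e) + (-1) *\<^sub>R pointwise_mult \<rho> w)"
  proof -
    have "B (x + y) = B x + B y" and "B (c *\<^sub>R x) = c *\<^sub>R B x" if "x \<in> H" "y \<in> H" for x y c
      using linB that by (simp_all add: linear_operator_in_def)
    then have "B ((- ?c) *\<^sub>R ?B' (A ?e) + (-1) *\<^sub>R pointwise_mult \<rho> w)
        = (- ?c) *\<^sub>R B (?B' (A ?e)) + (-1) *\<^sub>R B (pointwise_mult \<rho> w)"
      using AeB'H mult sub by (simp only: subspace_scale)
    then show ?thesis
      using bij_betw_inv_into_right[OF bij AeH] by simp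
  qed
  finally have B'_res: "?B' (?c *\<^sub>R A v - b) = (- ?c) *\<^sub>R ?B' (A ?e) + (-1) *\<^sub>R pointwise_mult \<rho> w"
    using bij AeB'H mult sub
    by (simp only: bij_betw_inv_into_left subspace_add subspace_scale)
  show ?thesis
    unfolding cheb_step_def normalized_operator_def op_A_bold_def B'_res
    using \<rho>0 by (simp add: vec_eq_iff pointwise_mult_def field_simps)
qed


section \<open>The convergence rate\<close>

theorem theorem2:
  fixes \<mu> \<rho> :: "'n::finite \<Rightarrow> real"
    and H :: "(real ^ 'n) set"
    and A B :: "real ^ 'n \<Rightarrow> real ^ 'n"
    and \<rho>_min ht \<alpha> \<epsilon>0 :: real
    and w b :: "real ^ 'n"
    and N :: nat
  assumes "euclidean_mesh_space \<mu> H"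
    and "selfadjoint_pos \<mu> H A"
    and "selfadjoint_pos \<mu> H B"
    and "\<forall>v\<in>H. A (B v) = B (A v)"
    and "0 < \<rho>_min" and "\<forall>i. \<rho>_min \<le> \<rho> i"
    and "\<forall>v\<in>H. pointwise_mult \<rho> v \<in> H"
    and "0 < ht"
    and "operator_le \<mu> H A (\<lambda>v. \<alpha>\<^sup>2 *\<^sub>R B v)"
    and "0 < \<epsilon>0" and "\<epsilon>0 < 1"
    and "1/6 * ht\<^sup>2 * \<alpha>\<^sup>2 \<le> (1 - \<epsilon>0\<^sup>2) * \<rho>_min"
    and "b \<in> H" and "w \<in> H"
    and "B (pointwise_mult \<rho> w) + (1/12 * ht\<^sup>2) *\<^sub>R A w = b"
    and "1 \<le> N"
  shows "(\<forall>W :: nat \<Rightarrow> real ^ 'n.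
            W 0 \<in> H \<and> (\<forall>l<N. W (l + 1) = cheb_step H \<rho> ht A B b (cheb_theta (\<epsilon>0\<^sup>2) N l) (W l)) \<longrightarrow>
              mesh_norm \<mu> (pointwise_mult (\<lambda>i. sqrt (\<rho> i)) (w - W N))
                \<le> 2 * q1 (\<epsilon>0\<^sup>2) ^ N / (1 + q1 (\<epsilon>0\<^sup>2) ^ (2 * N))
                    * mesh_norm \<mu> (pointwise_mult (\<lambda>i. sqrt (\<rho> i)) (w - W 0)) \<and>
              op_norm \<mu> (op_A_bold H \<rho> ht A B) (w - W N)
                \<le> 2 * q1 (\<epsilon>0\<^sup>2) ^ N / (1 + q1 (\<epsilon>0\<^sup>2) ^ (2 * N))
                    * op_norm \<mu> (op_A_bold H \<rho> ht A B) (w - W 0))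
       \<and> (\<forall>s::real. 0 \<le> s \<and> s < 1 \<longrightarrow>
            q1 s = (1 - s) / (5 - s + 4 * sqrt (1 + 1/2 * (1 - s))) \<and>
            q1 s \<le> 1 / (5 + 4 * sqrt (15/10)))
       \<and> \<bar>1 / (5 + 4 * sqrt (15/10)) - 1010/10000\<bar> \<le> (5/100000 :: real)"
proof (intro conjI allI impI)
  note H = assms(1) and A = assms(2) and B = assms(3)
  define s where "s = \<epsilon>0\<^sup>2"
  define q where "q = q1 s"
  define \<nu> where "\<nu> = (\<lambda>i. \<mu> i * \<rho> i)"
  define S where "S = normalized_operator H \<rho> ht A B"
  define M where "M = 2 * q ^ N / (1 + q ^ (2 * N))"
  have s: "0 \<le> s" "s < 1"
    using assms(10,11) by (simp_all add: s_def power_less_one_iff)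
  have \<rho>: "\<rho>_min \<le> \<rho> i" for i using assms(6) by blast
  have \<rho>pos: "0 < \<rho> i" for i using \<rho>[of i] assms(5) by linarith
  have \<rho>0: "\<rho> i \<noteq> 0" for i using \<rho>pos[of i] by simp
  have "1/6 * ht\<^sup>2 * \<alpha>\<^sup>2 \<le> (1 - s) * \<rho>_min"
    using assms(12) by (simp add: s_def)
  note spec = normalized_operator_spectrum[OF H A B assms(4) assms(9) assms(5) \<rho> assms(7)
      less_imp_le[OF s(2)] this, folded \<nu>_def S_def]
  have \<nu>H: "euclidean_mesh_space \<nu> H"
    unfolding \<nu>_def by (rule euclidean_mesh_space_weighted[OF H assms(5) \<rho>])
  have sub: "subspace H" using H by (simp add: euclidean_mesh_space_def)
  have SH: "S v \<in> H" if "v \<in> H" for v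
    using spec(1) that by (simp add: symmetric_in_def linear_operator_in_def)
  have linA: "linear_operator_in H A" using A by (simp add: selfadjoint_pos_def)
  have M0: "0 \<le> M"
    using q1_q0_relations(1)[OF s] by (simp add: M_def q_def)
  have weighted_norm: "mesh_norm \<mu> (pointwise_mult (\<lambda>i. sqrt (\<rho> i)) v) = sqrt (mesh_inner \<nu> v v)" for v
  proof -
    have "mesh_inner \<mu> (pointwise_mult (\<lambda>i. sqrt (\<rho> i)) v) (pointwise_mult (\<lambda>i. sqrt (\<rho> i)) v)
        = mesh_inner \<nu> v v"
      unfolding mesh_inner_def
    proof (intro sum.cong refl)
      fix i
      have "sqrt (\<rho> i) * sqrt (\<rho> i) = \<rho> i"
        using \<rho>pos[of i] by simp
      then show "\<mu> i * pointwise_mult (\<lambda>i. sqrt (\<rho> i)) v $ i * pointwise_mult (\<lambda>i. sqrt (\<rho> i)) v $ i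
          = \<nu> i * v $ i * v $ i"
        by (simp add: \<nu>_def pointwise_mult_def mult_ac)
    qed
    then show ?thesis by (simp add: mesh_norm_def)
  qed
  have energy_norm: "op_norm \<mu> (op_A_bold H \<rho> ht A B) v = sqrt (mesh_inner \<nu> (S v) v)" for v
    by (simp add: op_norm_def \<nu>_def S_def mesh_inner_normalized_operator[OF \<rho>0])
  fix W :: "nat \<Rightarrow> real ^ 'n"
  assume W: "W 0 \<in> H \<and> (\<forall>l<N. W (l + 1) = cheb_step H \<rho> ht A B b (cheb_theta (\<epsilon>0\<^sup>2) N l) (W l))"
  have step: "w - W (Suc l) = (w - W l) - cheb_theta s N l *\<^sub>R S (w - W l)"
    if "l < N" "W l \<in> H" for l
    using cheb_step_error[OF H linA B \<rho>0 _ assms(14,15) that(2)] W assms(7,14) that(1)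
    by (simp add: s_def S_def)
  have WH: "W l \<in> H" if "l \<le> N" for l
    using that
  proof (induction l)
    case (Suc l)
    then have dH: "w - W l \<in> H" and eq: "w - W (Suc l) = (w - W l) - cheb_theta s N l *\<^sub>R S (w - W l)"
      using step[of l] sub assms(14) by (simp_all only: subspace_diff Suc_le_eq less_imp_le)
    have "w - W (Suc l) \<in> H"
      unfolding eq by (rule subspace_diff[OF sub dH subspace_scale[OF sub SH[OF dH]]])
    from subspace_diff[OF sub assms(14) this] show ?case
      by simp
  qed (use W in simp)
  have "\<bar>\<Prod>l<N. 1 - cheb_theta s N l * x\<bar> \<le> M" if "1 \<le> x" "x \<le> lambda_bar s" for x
    unfolding M_def q_def by (rule chebyshev_residual_bound[OF s that])
  note bounds = residual_polynomial_bound[OF \<nu>H spec(1), where lo = 1 and hi = "lambda_bar s"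
      and e = "\<lambda>l. w - W l" and N = N and \<theta> = "cheb_theta s N" and M = M]
  have "mesh_inner \<nu> (w - W N) (w - W N) \<le> M\<^sup>2 * mesh_inner \<nu> (w - W 0) (w - W 0)"
    using spec(2,3) W sub assms(14) step WH \<open>\<And>x. _ \<Longrightarrow> _ \<Longrightarrow> _ \<le> M\<close>
    by (intro bounds(1)) (auto simp: subspace_diff)
  then have "sqrt (mesh_inner \<nu> (w - W N) (w - W N)) \<le> M * sqrt (mesh_inner \<nu> (w - W 0) (w - W 0))"
    using M0 by (metis abs_of_nonneg real_sqrt_abs real_sqrt_le_mono real_sqrt_mult)
  then show "mesh_norm \<mu> (pointwise_mult (\<lambda>i. sqrt (\<rho> i)) (w - W N))
      \<le> 2 * q1 (\<epsilon>0\<^sup>2) ^ N / (1 + q1 (\<epsilon>0\<^sup>2) ^ (2 * N))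
        * mesh_norm \<mu> (pointwise_mult (\<lambda>i. sqrt (\<rho> i)) (w - W 0))"
    by (simp add: weighted_norm M_def q_def s_def)
  have "mesh_inner \<nu> (S (w - W N)) (w - W N) \<le> M\<^sup>2 * mesh_inner \<nu> (S (w - W 0)) (w - W 0)"
    using spec(2,3) W sub assms(14) step WH \<open>\<And>x. _ \<Longrightarrow> _ \<Longrightarrow> _ \<le> M\<close>
    by (intro bounds(2)) (auto simp: subspace_diff)
  then have "sqrt (mesh_inner \<nu> (S (w - W N)) (w - W N))
      \<le> M * sqrt (mesh_inner \<nu> (S (w - W 0)) (w - W 0))"
    using M0 by (metis abs_of_nonneg real_sqrt_abs real_sqrt_le_mono real_sqrt_mult)
  then show "op_norm \<mu> (op_A_bold H \<rho> ht A B) (w - W N)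
      \<le> 2 * q1 (\<epsilon>0\<^sup>2) ^ N / (1 + q1 (\<epsilon>0\<^sup>2) ^ (2 * N))
        * op_norm \<mu> (op_A_bold H \<rho> ht A B) (w - W 0)"
    by (simp add: energy_norm M_def q_def s_def)
next
  fix s :: real
  assume "0 \<le> s \<and> s < 1"
  then show "q1 s = (1 - s) / (5 - s + 4 * sqrt (1 + 1/2 * (1 - s)))"
    using q1_q0_relations(5) by blast
next
  fix s :: real
  assume "0 \<le> s \<and> s < 1"
  then show "q1 s \<le> 1 / (5 + 4 * sqrt (15/10))"
    using q1_le by blast
next
  show "\<bar>1 / (5 + 4 * sqrt (15/10)) - 1010/10000\<bar> \<le> (5/100000 :: real)"
    by (rule q1_numeric)
qed

end
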